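(* Let $d\ge1$ be an integer, $p\in(1,\infty)$, and let $X$ be a linear subspace of $M_d(\mathbb R)$. For $C\ge 0$ let $$f_C(A)=C^p\|P_X(A)\|^p-\|Q_X(A)\|^p,\qquad A\in M_d(\mathbb R).$$ Then there exists a $C$ such that the rank-one convex envelope $f_C^{rc}$ is real-valued if and only if $X^\perp$ contains no matrix of rank one. In that case one can choose $C=(p^*-1)B$, where $$B^{-1}=\inf_{A\in M_d(\mathbb R):\ \mathrm{rank}(A)=1}\frac{\|P_X(A)\|}{\|Q_X(A)\|}\qquad\text{and}\qquad p^*=\max\Big(p,\frac{p}{p-1}\Big).$$
   Context: $M_d(\mathbb R)$, the space of real $d\times d$ matrices, carries the Frobenius inner product $\langle A,B\rangle=\mathrm{Tr}(AB^t)$ and norm $\|A\|^2=\mathrm{Tr}(AA^t)$. $P_X$ and $Q_X$ are the orthogonal projections onto $X$ and $X^\perp$ respectively. A function $g\colon M_d(\mathbb R)\to\mathbb R$ is rank-one convex if it is convex on each segment joining two matrices $A,B$ with $\mathrm{rank}(A-B)=1$. The rank-one convex envelope of $f$ is $f^{rc}(A)=\sup\{g(A): g\le f,\ g \text{ rank-one convex}\}$ (with $\sup\emptyset=-\infty$). The ratio $\|P_X(A)\|/\|Q_X(A)\|$ is interpreted as $+\infty$ when $Q_X(A)=0$, and $B=0$ if the infimum is $+\infty$. *)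

theory Defs
  imports "HOL-Analysis.Analysis"
begin

text \<open>The Euclidean structure which \<open>HOL-Analysis\<close> puts on \<open>real ^ 'd ^ 'd\<close> is the Frobenius one.\<close>

lemma inner_matrix_eq_trace:
  fixes A B :: "real ^ 'd ^ 'd"
  shows "A \<bullet> B = trace (A ** transpose B)"
  by (simp add: trace_def matrix_matrix_mult_def transpose_def inner_vec_def)

lemma norm_matrix_eq_trace:
  fixes A :: "real ^ 'd ^ 'd"
  shows "(norm A)\<^sup>2 = trace (A ** transpose A)"
  by (simp add: power2_norm_eq_inner inner_matrix_eq_trace)

definition orth_proj :: "'a::real_inner set \<Rightarrow> 'a \<Rightarrow> 'a" where
  "orth_proj X a = (THE b. b \<in> X \<and> a - b \<in> orthogonal_comp X)"

lemma orth_proj_ex1: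
  fixes X :: "'a::euclidean_space set"
  assumes "subspace X"
  shows "\<exists>!b. b \<in> X \<and> a - b \<in> orthogonal_comp X"
proof -
  obtain y z where y: "y \<in> span X" and z: "\<And>w. w \<in> span X \<Longrightarrow> orthogonal z w" and a: "a = y + z"
    using orthogonal_subspace_decomp_exists[of X a] by blast
  have sp: "span X = X" using assms by (simp add: span_eq_iff)
  show ?thesis
  proof (rule ex1I[of _ y])
    show "y \<in> X \<and> a - y \<in> orthogonal_comp X"
      using y z a sp by (simp add: orthogonal_comp_def orthogonal_commute)
  next
    fix b assume b: "b \<in> X \<and> a - b \<in> orthogonal_comp X"
    have "a - y \<in> orthogonal_comp X"
      using y z a sp by (simp add: orthogonal_comp_def orthogonal_commute)
    then have "(a - y) - (a - b) \<in> orthogonal_comp X"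
      using b subspace_diff[OF subspace_orthogonal_comp] by blast
    then have "b - y \<in> orthogonal_comp X" by simp
    moreover have "b - y \<in> X" using b y sp assms by (simp add: subspace_diff)
    ultimately have "orthogonal (b - y) (b - y)" by (auto simp: orthogonal_comp_def)
    then show "b = y" by (simp add: orthogonal_self)
  qed
qed

definition rank_one_convex :: "(real ^ 'd ^ 'd \<Rightarrow> real) \<Rightarrow> bool" where
  "rank_one_convex g \<longleftrightarrow> (\<forall>A B. rank (A - B) = 1 \<longrightarrow> convex_on (closed_segment A B) g)"

text \<open>In \<open>ereal\<close> the supremum of the empty set is \<open>-\<infinity>\<close>.\<close>

definition rc_envelope :: "(real ^ 'd ^ 'd \<Rightarrow> real) \<Rightarrow> real ^ 'd ^ 'd \<Rightarrow> ereal" where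
  "rc_envelope f A = (SUP g\<in>{g. rank_one_convex g \<and> (\<forall>M. g M \<le> f M)}. ereal (g A))"

definition rc_envelope_real_valued :: "(real ^ 'd ^ 'd \<Rightarrow> real) \<Rightarrow> bool" where
  "rc_envelope_real_valued f \<longleftrightarrow> (\<forall>A. \<bar>rc_envelope f A\<bar> \<noteq> \<infinity>)"

definition f_C :: "(real ^ 'd ^ 'd) set \<Rightarrow> real \<Rightarrow> real \<Rightarrow> real ^ 'd ^ 'd \<Rightarrow> real" where
  "f_C X p C A = C powr p * norm (orth_proj X A) powr p
                   - norm (orth_proj (orthogonal_comp X) A) powr p"

definition proj_ratio :: "(real ^ 'd ^ 'd) set \<Rightarrow> real ^ 'd ^ 'd \<Rightarrow> ereal" where
  "proj_ratio X A =
     (if orth_proj (orthogonal_comp X) A = 0 then \<infinity>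
      else ereal (norm (orth_proj X A) / norm (orth_proj (orthogonal_comp X) A)))"

text \<open>
  The constant \<open>B\<close> as an extended real. In \<open>ereal\<close>, \<open>inverse \<infinity> = 0\<close>
  and \<open>inverse 0 = \<infinity>\<close>.
\<close>

definition ratio_const :: "(real ^ 'd ^ 'd) set \<Rightarrow> ereal" where
  "ratio_const X = inverse (INF A\<in>{A. rank A = 1}. proj_ratio X A)"

definition p_star :: "real \<Rightarrow> real" where
  "p_star p = max p (p / (p - 1))"

end

theory Submission
  imports Defs
begin

text \<open>
  If \<open>X\<^sup>\<bottom>\<close> contains a matrix \<open>A\<close> of rank one, then on the line spanned by \<open>A\<close> the function \<open>f_C X p C\<close> is a
  negative multiple of \<open>\<bar>t\<bar> powr p\<close>. No convex function lies below it, so the envelope is \<open>- \<infinity>\<close>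
  (\<open>not_rc_envelope_real_valued_f_C\<close>).

  Suppose now that \<open>X\<^sup>\<bottom>\<close> contains no matrix of rank one. The unit matrices of rank one form a compact
  set, so the ratio in the definition of \<open>B\<close> is bounded away from \<open>0\<close>. Hence \<open>B\<close> is finite, and
  \<open>norm (Q H) \<le> B * norm (P H)\<close> for all \<open>H\<close> of rank one, where \<open>P\<close> and \<open>Q\<close> are the projections to \<open>X\<close> and \<open>X\<^sup>\<bottom>\<close>
  (\<open>ratio_const_finite\<close>). It suffices to find one rank-one convex function below
  \<open>f_C X p ((p_star p - 1) * B)\<close>. Up to sign, Burkholder's special function from the theory of martingale
  transforms is such a minorant: with \<open>r = B * norm (P A)\<close> and \<open>s = norm (Q A)\<close>, take a positive multiple of
  \<open>((p_star p - 1) * r - s) * (r + s) powr (p - 1)\<close>.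

  Two properties of that function do the work. It is convex on lines along which the first component
  moves at least as fast as the second (\<open>burkholder_function_convex_on_line\<close>), and by the choice of \<open>B\<close> these
  include all lines in a direction of rank one. Also, it is at most
  \<open>((p_star p - 1) * r) powr p - s powr p\<close> (\<open>burkholder_function_le\<close>). The first property is an explicit second
  derivative, the second a one-variable monotonicity argument. Norms are not differentiable at \<open>0\<close>; both
  are therefore proved for positive arguments, with norms replaced by \<open>sqrt ((norm x)\<^sup>2 + e\<^sup>2)\<close>, before \<open>e\<close>
  tends to \<open>0\<close>.
\<close>

section \<open>The Burkholder form along lines\<close>

text \<open>
  For \<open>2 \<le> p\<close> this is Burkholder's function up to a positive factor; for \<open>p \<le> 2\<close> one exchanges the
  two arguments and changes the sign. One formula for both ranges of \<open>p\<close> lets a single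
  second derivative and a single tangent estimate serve both.
\<close>

definition burkholder_form :: "real \<Rightarrow> real \<Rightarrow> real \<Rightarrow> real" where
  "burkholder_form p r s = ((p - 1) * r - s) * (r + s) powr (p - 1)"

lemma powr_split:
  fixes m a :: real
  assumes "0 < m"
  shows "m powr (a - 1) = m powr (a - 2) * m" "m powr (a - 2) = m powr (a - 3) * m"
proof -
  have "m powr (a - 2 + 1) = m powr (a - 2) * m" "m powr (a - 3 + 1) = m powr (a - 3) * m"
    using assms by (simp_all only: powr_add powr_one)
  moreover have "a - 2 + 1 = a - 1" "a - 3 + 1 = a - 2" by simp_all
  ultimately show "m powr (a - 1) = m powr (a - 2) * m" "m powr (a - 2) = m powr (a - 3) * m"
    by simp_all
qed

lemma DERIV_burkholder_form:
  fixes r s :: "real \<Rightarrow> real"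
  assumes r: "(r has_real_derivative r') (at t)" and s: "(s has_real_derivative s') (at t)"
    and pos: "0 < r t + s t"
  shows "((\<lambda>t. burkholder_form p (r t) (s t)) has_real_derivative
    p * (r t + s t) powr (p - 2) * ((p - 1) * r t * (r' + s') - (r t + s t) * s')) (at t)"
proof -
  have "((\<lambda>t. (r t + s t) powr (p - 1)) has_real_derivative
      (p - 1) * (r t + s t) powr (p - 1 - 1) * (r' + s')) (at t)"
    using DERIV_fun_powr[OF DERIV_add[OF r s] pos, of "p - 1"] by simp
  then have pw: "((\<lambda>t. (r t + s t) powr (p - 1)) has_real_derivative
      (p - 1) * (r t + s t) powr (p - 2) * (r' + s')) (at t)" by simp
  show ?thesis
    unfolding burkholder_form_def
    by (rule derivative_eq_intros r s pw refl)+
      (simp add: powr_split(1)[OF pos] algebra_simps)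
qed

text \<open>
  The terms are grouped so that the second derivatives of \<open>r\<^sup>2 / 2\<close> and \<open>s\<^sup>2 / 2\<close> appear. If \<open>r\<close> and \<open>s\<close> are
  norms along a line, these are the squared speeds of the two components, and what remains has the
  sign of \<open>p - 2\<close> because \<open>s\<close> is convex.
\<close>

lemma DERIV2_burkholder_form:
  fixes r s r' s' :: "real \<Rightarrow> real"
  assumes r: "(r has_real_derivative r' t) (at t)" and s: "(s has_real_derivative s' t) (at t)"
    and r': "(r' has_real_derivative r'') (at t)" and s': "(s' has_real_derivative s'') (at t)"
    and pos: "0 < r t + s t"
  shows "((\<lambda>t. p * (r t + s t) powr (p - 2) * ((p - 1) * r t * (r' t + s' t) - (r t + s t) * s' t))
     has_real_derivative
      p * (r t + s t) powr (p - 3) *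
       ((p - 1) * (p - 2) * r t * (r' t + s' t)\<^sup>2
        + (r t + s t) * ((p - 1) * ((r' t)\<^sup>2 + r t * r'' - ((s' t)\<^sup>2 + s t * s''))
                         + (p - 2) * (r t + s t) * s''))) (at t)"
proof -
  have "((\<lambda>t. (r t + s t) powr (p - 2)) has_real_derivative
      (p - 2) * (r t + s t) powr (p - 2 - 1) * (r' t + s' t)) (at t)"
    using DERIV_fun_powr[OF DERIV_add[OF r s] pos, of "p - 2"] by simp
  then have pw: "((\<lambda>t. (r t + s t) powr (p - 2)) has_real_derivative
      (p - 2) * (r t + s t) powr (p - 3) * (r' t + s' t)) (at t)" by simp
  show ?thesis
    by (rule derivative_eq_intros r s r' s' pw refl)+
      (simp add: powr_split(2)[OF pos] algebra_simps power2_eq_square)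
qed

text \<open>
  Adding \<open>e\<^sup>2\<close> amounts to giving the vector one more constant coordinate \<open>e\<close>. The norm then never
  vanishes and is smooth along the line, while its square keeps the second derivative
  \<open>2 * (norm h)\<^sup>2\<close>; convexity is the Cauchy-Schwarz inequality.
\<close>

lemma smoothed_norm_on_line:
  fixes x h :: "'a::real_inner"
  assumes "e > 0"
  obtains r r' r'' :: "real \<Rightarrow> real" where
    "\<And>t. r t = sqrt ((norm (x + t *\<^sub>R h))\<^sup>2 + e\<^sup>2)" "\<And>t. 0 < r t"
    "\<And>t. (r has_real_derivative r' t) (at t)" "\<And>t. (r' has_real_derivative r'' t) (at t)"
    "\<And>t. 0 \<le> r'' t" "\<And>t. (r' t)\<^sup>2 + r t * r'' t = (norm h)\<^sup>2"
proof -
  define r where "r t = sqrt ((norm (x + t *\<^sub>R h))\<^sup>2 + e\<^sup>2)" for t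
  define r' where "r' t = ((x + t *\<^sub>R h) \<bullet> h) / r t" for t
  define r'' where "r'' t = ((norm h)\<^sup>2 - (r' t)\<^sup>2) / r t" for t
  have rpos: "0 < r t" for t
    unfolding r_def using assms by (simp add: add_nonneg_pos)
  have rsq: "(r t)\<^sup>2 = (norm (x + t *\<^sub>R h))\<^sup>2 + e\<^sup>2" for t
    unfolding r_def by simp
  have q: "(norm (x + t *\<^sub>R h))\<^sup>2 = x \<bullet> x + 2 * t * (x \<bullet> h) + t\<^sup>2 * (h \<bullet> h)" for t
    by (simp only: power2_norm_eq_inner)
      (simp add: inner_add_left inner_add_right inner_commute[of h x] power2_eq_square algebra_simps)
  have dr: "(r has_real_derivative r' t) (at t)" for t
  proof -
    have pos: "0 < x \<bullet> x + 2 * t * (x \<bullet> h) + t\<^sup>2 * (h \<bullet> h) + e\<^sup>2"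
      using rpos[of t] rsq[of t] q[of t] by (metis zero_less_power)
    have "((\<lambda>t. sqrt (x \<bullet> x + 2 * t * (x \<bullet> h) + t\<^sup>2 * (h \<bullet> h) + e\<^sup>2)) has_real_derivative r' t) (at t)"
    proof (rule DERIV_cong)
      have "((\<lambda>t. x \<bullet> x + 2 * t * (x \<bullet> h) + t\<^sup>2 * (h \<bullet> h) + e\<^sup>2) has_real_derivative
          2 * (x \<bullet> h + t * (h \<bullet> h))) (at t)"
        by (auto intro!: derivative_eq_intros)
      from DERIV_chain2[OF DERIV_real_sqrt[OF pos] this]
      show "((\<lambda>t. sqrt (x \<bullet> x + 2 * t * (x \<bullet> h) + t\<^sup>2 * (h \<bullet> h) + e\<^sup>2)) has_real_derivative
          inverse (sqrt (x \<bullet> x + 2 * t * (x \<bullet> h) + t\<^sup>2 * (h \<bullet> h) + e\<^sup>2)) / 2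
            * (2 * (x \<bullet> h + t * (h \<bullet> h)))) (at t)" .
    qed (simp add: r'_def r_def q inner_add_left inverse_eq_divide del: distrib_left_numeral)
    then show ?thesis unfolding r_def q .
  qed
  have r''_eq: "r'' t = (h \<bullet> h - (r' t)\<^sup>2) / r t" for t
    by (simp add: r''_def power2_norm_eq_inner)
  have dr': "(r' has_real_derivative r'' t) (at t)" for t
    unfolding r'_def inner_add_left inner_scaleR_left
    by (rule derivative_eq_intros dr refl)+
      (use rpos[of t] in \<open>auto simp: r''_eq r'_def inner_add_left power2_eq_square field_simps\<close>)
  have "(r' t)\<^sup>2 \<le> (norm h)\<^sup>2" for t
  proof -
    have "((x + t *\<^sub>R h) \<bullet> h)\<^sup>2 \<le> (norm (x + t *\<^sub>R h))\<^sup>2 * (norm h)\<^sup>2"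
      by (simp add: Cauchy_Schwarz_ineq power2_norm_eq_inner)
    also have "\<dots> \<le> (r t)\<^sup>2 * (norm h)\<^sup>2"
      unfolding rsq by (intro mult_right_mono) simp_all
    finally show ?thesis
      using rpos[of t] by (simp add: r'_def power_divide divide_le_eq mult.commute)
  qed
  then have "0 \<le> r'' t" for t
    using rpos[of t] by (simp add: r''_def)
  moreover have "(r' t)\<^sup>2 + r t * r'' t = (norm h)\<^sup>2" for t
    using rpos[of t] by (simp add: r''_def)
  ultimately show thesis
    by (intro that[of r r' r'']) (use r_def rpos dr dr' in auto)
qed

text \<open>
  The second derivative is the sum of a positive multiple of \<open>(norm h)\<^sup>2 - (norm k)\<^sup>2\<close>
  and of terms with the sign of \<open>p - 2\<close>. So the form is convex for \<open>2 \<le> p\<close> when the first component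
  moves faster, and concave for \<open>p \<le> 2\<close> when the second one does.
\<close>

lemma convex_on_burkholder_form_smoothed:
  fixes x h :: "'a::real_inner" and y k :: "'b::real_inner"
  assumes "e > 0" "1 < p"
  defines "R \<equiv> \<lambda>t. sqrt ((norm (x + t *\<^sub>R h))\<^sup>2 + e\<^sup>2)"
    and "S \<equiv> \<lambda>t. sqrt ((norm (y + t *\<^sub>R k))\<^sup>2 + e\<^sup>2)"
  shows "2 \<le> p \<Longrightarrow> norm k \<le> norm h \<Longrightarrow> convex_on UNIV (\<lambda>t. burkholder_form p (R t) (S t))"
    and "p \<le> 2 \<Longrightarrow> norm h \<le> norm k \<Longrightarrow> convex_on UNIV (\<lambda>t. - burkholder_form p (R t) (S t))"
proof -
  obtain r r' r'' where r: "\<And>t. r t = sqrt ((norm (x + t *\<^sub>R h))\<^sup>2 + e\<^sup>2)" "\<And>t. 0 < r t"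
    "\<And>t. (r has_real_derivative r' t) (at t)" "\<And>t. (r' has_real_derivative r'' t) (at t)"
    "\<And>t. 0 \<le> r'' t" "\<And>t. (r' t)\<^sup>2 + r t * r'' t = (norm h)\<^sup>2"
    using smoothed_norm_on_line[OF assms(1), of x h] by blast
  obtain s s' s'' where s: "\<And>t. s t = sqrt ((norm (y + t *\<^sub>R k))\<^sup>2 + e\<^sup>2)" "\<And>t. 0 < s t"
    "\<And>t. (s has_real_derivative s' t) (at t)" "\<And>t. (s' has_real_derivative s'' t) (at t)"
    "\<And>t. 0 \<le> s'' t" "\<And>t. (s' t)\<^sup>2 + s t * s'' t = (norm k)\<^sup>2"
    using smoothed_norm_on_line[OF assms(1), of y k] by blast
  have R: "R = r" and S: "S = s"
    by (auto simp: R_def S_def r(1) s(1))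
  have pos: "0 < r t + s t" for t
    using r(2) s(2) by (simp add: add_pos_pos)
  let ?D1 = "\<lambda>t. p * (r t + s t) powr (p - 2) * ((p - 1) * r t * (r' t + s' t) - (r t + s t) * s' t)"
  let ?D2 = "\<lambda>t. p * (r t + s t) powr (p - 3) *
       ((p - 1) * (p - 2) * r t * (r' t + s' t)\<^sup>2
        + (r t + s t) * ((p - 1) * ((norm h)\<^sup>2 - (norm k)\<^sup>2) + (p - 2) * (r t + s t) * s'' t))"
  have d1: "((\<lambda>t. burkholder_form p (r t) (s t)) has_real_derivative ?D1 t) (at t)" for t
    by (rule DERIV_burkholder_form[OF r(3) s(3) pos])
  have d2: "(?D1 has_real_derivative ?D2 t) (at t)" for t
    using DERIV2_burkholder_form[where r = r and s = s and r' = r' and s' = s', OF r(3) s(3) r(4) s(4) pos, of p t]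
    unfolding r(6) s(6) .
  show "convex_on UNIV (\<lambda>t. burkholder_form p (R t) (S t))" if "2 \<le> p" "norm k \<le> norm h"
    unfolding R S
  proof (rule f''_ge0_imp_convex[where f' = ?D1 and f'' = ?D2])
    fix t
    have "(norm k)\<^sup>2 \<le> (norm h)\<^sup>2" using that by (simp add: power_mono)
    then show "0 \<le> ?D2 t"
      using that assms(2) r(2)[of t] s(2)[of t] s(5)[of t]
      by (intro mult_nonneg_nonneg add_nonneg_nonneg) auto
  qed (use d1 d2 in auto)
  show "convex_on UNIV (\<lambda>t. - burkholder_form p (R t) (S t))" if "p \<le> 2" "norm h \<le> norm k"
    unfolding R S
  proof (rule f''_ge0_imp_convex[where f' = "\<lambda>t. - ?D1 t" and f'' = "\<lambda>t. - ?D2 t"])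
    fix t
    have "(norm h)\<^sup>2 \<le> (norm k)\<^sup>2" using that by (simp add: power_mono)
    then have *: "(p - 1) * ((norm h)\<^sup>2 - (norm k)\<^sup>2) + (p - 2) * (r t + s t) * s'' t \<le> 0"
      using that assms(2) pos[of t] s(5)[of t]
      by (intro add_nonpos_nonpos mult_nonneg_nonpos mult_nonpos_nonneg) auto
    have **: "(p - 1) * (p - 2) * r t * (r' t + s' t)\<^sup>2 \<le> 0"
      using that assms(2) r(2)[of t]
      by (intro mult_nonpos_nonneg mult_nonneg_nonpos) auto
    have "?D2 t \<le> 0"
      using add_nonpos_nonpos[OF ** mult_nonneg_nonpos[OF less_imp_le[OF pos[of t]] *]] assms(2)
      by (intro mult_nonneg_nonpos) auto
    then show "0 \<le> - ?D2 t" by simp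
  qed (use d1 d2 in \<open>auto intro!: DERIV_minus\<close>)
qed

text \<open>
  As a function of \<open>u\<close>, the bracket vanishes at \<open>u = s\<close> and has derivative
  \<open>p * u * (u powr (p - 2) - w powr (p - 2))\<close>. The point \<open>w\<close> is a weighted mean of \<open>u\<close> and \<open>s\<close>, so it lies
  between them; multiplied by \<open>p - 2\<close>, the bracket therefore decreases up to \<open>u = s\<close> and increases
  afterwards. The factor \<open>p - 2\<close> treats both ranges of \<open>p\<close> at once.
\<close>

lemma burkholder_tangent_gap_sign:
  fixes p u s :: real
  assumes "1 < p" "0 < u" "0 < s"
  defines "w \<equiv> (u + (p - 1) * s) / p"
  shows "0 \<le> (p - 2) * (u powr p - s powr p - p * (u - s) * w powr (p - 1))"
proof -
  define W where "W v = (v + (p - 1) * s) / p" for v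
  define E where "E v = (p - 2) * (v powr p - s powr p - p * (v - s) * W v powr (p - 1))" for v
  have Wpos: "0 < W v" if "0 < v" for v
    using that assms by (simp add: W_def add_pos_pos)
  have dE: "(E has_real_derivative (p - 2) * (p * v * (v powr (p - 2) - W v powr (p - 2)))) (at v)"
    if v: "0 < v" for v
  proof -
    have pw: "((\<lambda>v. W v powr (p - 1)) has_real_derivative
        (p - 1) * W v powr (p - 2) * (1 / p)) (at v)"
    proof -
      have "(W has_real_derivative 1 / p) (at v)"
        unfolding W_def by (rule DERIV_cong, (rule derivative_intros)+) (use assms(1) in simp_all)
      from DERIV_fun_powr[OF this Wpos[OF v], of "p - 1"] show ?thesis by simp
    qed
    have vp: "((\<lambda>v. v powr p) has_real_derivative p * v powr (p - 1)) (at v)"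
      by (rule has_real_derivative_powr[OF v])
    have "(E has_real_derivative (p - 2) * (p * v powr (p - 1)
        - (p * W v powr (p - 1) + p * (v - s) * ((p - 1) * W v powr (p - 2) * (1 / p))))) (at v)"
      unfolding E_def by (rule DERIV_cong, (rule derivative_intros vp pw)+) simp
    moreover have "p * v powr (p - 1)
        - (p * W v powr (p - 1) + p * (v - s) * ((p - 1) * W v powr (p - 2) * (1 / p)))
        = p * v * (v powr (p - 2) - W v powr (p - 2))"
    proof -
      have "p * W v = v + (p - 1) * s"
        using assms(1) by (simp add: W_def)
      then have weight: "p * W v + (v - s) * (p - 1) = p * v"
        by (simp add: algebra_simps)
      have "p * (v - s) * ((p - 1) * W v powr (p - 2) * (1 / p)) = (v - s) * (p - 1) * W v powr (p - 2)"
        using assms(1) by simp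
      then have "p * v powr (p - 1)
          - (p * W v powr (p - 1) + p * (v - s) * ((p - 1) * W v powr (p - 2) * (1 / p)))
          = p * v * v powr (p - 2) - W v powr (p - 2) * (p * W v + (v - s) * (p - 1))"
        by (simp add: powr_split(1)[OF v] powr_split(1)[OF Wpos[OF v]] algebra_simps)
      also have "\<dots> = p * v * (v powr (p - 2) - W v powr (p - 2))"
        unfolding weight by (simp add: algebra_simps)
      finally show ?thesis .
    qed
    ultimately show ?thesis by simp
  qed
  have gap: "W v - v = (p - 1) / p * (s - v)" for v
    using assms(1) by (simp add: W_def field_simps)
  have sW: "v \<le> W v \<longleftrightarrow> v \<le> s" "W v \<le> v \<longleftrightarrow> s \<le> v" for v
  proof -
    have "0 < (p - 1) / p" using assms(1) by simp
    then have "0 \<le> W v - v \<longleftrightarrow> 0 \<le> s - v" "W v - v \<le> 0 \<longleftrightarrow> s - v \<le> 0"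
      unfolding gap by (simp_all only: zero_le_mult_iff mult_le_0_iff) auto
    then show "v \<le> W v \<longleftrightarrow> v \<le> s" "W v \<le> v \<longleftrightarrow> s \<le> v" by auto
  qed
  \<comment> \<open>\<open>x powr (p - 2)\<close> is increasing or decreasing according to the sign of \<open>p - 2\<close>.\<close>
  have mono: "0 \<le> (p - 2) * (b powr (p - 2) - a powr (p - 2))" if "0 < a" "a \<le> b" for a b
  proof (cases "2 \<le> p")
    case True then show ?thesis using that by (intro mult_nonneg_nonneg) (auto intro: powr_mono2)
  next
    case False then show ?thesis using that by (intro mult_nonpos_nonpos) (auto intro: powr_mono2')
  qed
  have "E s \<le> E u"
  proof (cases "s \<le> u")
    case True
    show ?thesis
    proof (rule DERIV_nonneg_imp_nondecreasing[OF True])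
      fix v assume v: "s \<le> v" "v \<le> u"
      then have "0 < v" using assms by simp
      moreover have "0 \<le> (p - 2) * (p * v * (v powr (p - 2) - W v powr (p - 2)))"
        using mono[OF Wpos[OF \<open>0 < v\<close>], of v] sW[of v] v \<open>0 < v\<close> assms(1)
        by (simp add: mult.left_commute[of "p - 2"] del: mult_le_0_iff)
      ultimately show "\<exists>y. (E has_real_derivative y) (at v) \<and> 0 \<le> y"
        using dE by blast
    qed
  next
    case False
    then have "u \<le> s" by simp
    then show ?thesis
    proof (rule DERIV_nonpos_imp_nonincreasing)
      fix v assume v: "u \<le> v" "v \<le> s"
      then have "0 < v" using assms by simp
      have "0 \<le> (p - 2) * (W v powr (p - 2) - v powr (p - 2))"
        using mono[OF \<open>0 < v\<close>, of "W v"] sW[of v] v by simp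
      then have "0 \<le> p * v * ((p - 2) * (W v powr (p - 2) - v powr (p - 2)))"
        using \<open>0 < v\<close> assms(1) mult_nonneg_nonneg[of "p * v"] by simp
      then have "(p - 2) * (p * v * (v powr (p - 2) - W v powr (p - 2))) \<le> 0"
        by (simp add: algebra_simps)
      then show "\<exists>y. (E has_real_derivative y) (at v) \<and> y \<le> 0"
        using dE[OF \<open>0 < v\<close>] by blast
    qed
  qed
  then show ?thesis by (simp add: E_def W_def w_def)
qed

text \<open>
  This is the tangent estimate at \<open>u = (p - 1) * r\<close>, where the weighted mean is a multiple of \<open>r + s\<close>.
\<close>

lemma burkholder_form_gap_sign:
  fixes p r s :: real
  assumes "1 < p" "0 < r" "0 < s"
  shows "0 \<le> (p - 2) * (((p - 1) * r) powr p - s powr p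
            - p * ((p - 1) / p) powr (p - 1) * burkholder_form p r s)"
proof -
  have eq: "(((p - 1) * r + (p - 1) * s) / p) powr (p - 1)
      = ((p - 1) / p) powr (p - 1) * (r + s) powr (p - 1)"
  proof -
    have "((p - 1) * r + (p - 1) * s) / p = ((p - 1) / p) * (r + s)"
      by (simp add: distrib_left add_divide_distrib)
    then show ?thesis by (simp only: powr_mult)
  qed
  have "0 \<le> (p - 2) * (((p - 1) * r) powr p - s powr p
      - p * ((p - 1) * r - s) * (((p - 1) * r + (p - 1) * s) / p) powr (p - 1))"
    using burkholder_tangent_gap_sign[of p "(p - 1) * r" s] assms by simp
  then show ?thesis unfolding eq burkholder_form_def by (simp only: mult_ac)
qed

section \<open>Burkholder's function\<close>

text \<open>
  This is \<open>p * (1 - 1 / p_star p) powr (p - 1) * ((p_star p - 1) * r - s) * (r + s) powr (p - 1)\<close> for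
  \<open>0 \<le> r\<close> and \<open>0 \<le> s\<close>, that is, minus Burkholder's special function. The constant in front is the one for which it
  touches \<open>((p_star p - 1) * r) powr p - s powr p\<close> along the ray \<open>s = (p_star p - 1) * r\<close>.
\<close>

definition burkholder_function :: "real \<Rightarrow> real \<Rightarrow> real \<Rightarrow> real" where
  "burkholder_function p r s =
     (if 2 \<le> p then p * ((p - 1) / p) powr (p - 1) * burkholder_form p r s
      else - (p * ((p - 1) / p) powr (p - 1) / (p - 1) powr p * burkholder_form p s r))"

lemma p_star_minus_one:
  assumes "1 < p"
  shows "p_star p - 1 = (if 2 \<le> p then p - 1 else 1 / (p - 1))"
proof (cases "2 \<le> p")
  case True
  then have "p \<le> p * (p - 1)" by simp
  then have "p / (p - 1) \<le> p" using assms by (simp add: divide_le_eq)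
  then show ?thesis using True by (simp add: p_star_def)
next
  case False
  then have "p * (p - 1) \<le> p" using assms by (simp add: mult_le_cancel_left1)
  then have "p \<le> p / (p - 1)" using assms by (simp add: le_divide_eq)
  then show ?thesis using False assms by (simp add: p_star_def field_simps)
qed

text \<open>
  Continuity up to the boundary of the quadrant, which carries every estimate for the smoothed norms
  over to the norms themselves.
\<close>

lemma tendsto_burkholder_form:
  assumes "1 < p" "(f \<longlongrightarrow> r) F" "(g \<longlongrightarrow> s) F" "\<forall>\<^sub>F e in F. 0 \<le> f e" "\<forall>\<^sub>F e in F. 0 \<le> g e"
  shows "((\<lambda>e. burkholder_form p (f e) (g e)) \<longlongrightarrow> burkholder_form p r s) F"
proof -
  have nonneg: "\<forall>\<^sub>F e in F. 0 \<le> f e + g e"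
    using assms(4,5) by eventually_elim simp
  have "((\<lambda>e. (f e + g e) powr (p - 1)) \<longlongrightarrow> (r + s) powr (p - 1)) F"
    using assms nonneg by (intro tendsto_powr' tendsto_add tendsto_const) auto
  then show ?thesis
    unfolding burkholder_form_def by (intro tendsto_mult tendsto_diff tendsto_const assms)
qed

lemma tendsto_burkholder_function:
  assumes "1 < p" "(f \<longlongrightarrow> r) F" "(g \<longlongrightarrow> s) F" "\<forall>\<^sub>F e in F. 0 \<le> f e" "\<forall>\<^sub>F e in F. 0 \<le> g e"
  shows "((\<lambda>e. burkholder_function p (f e) (g e)) \<longlongrightarrow> burkholder_function p r s) F"
  unfolding burkholder_function_def
  using tendsto_burkholder_form[OF assms] tendsto_burkholder_form[OF assms(1,3,2,5,4)]
  by (cases "2 \<le> p") (simp_all only: if_True if_False tendsto_mult tendsto_minus tendsto_const)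

lemma burkholder_function_le_pos:
  assumes "1 < p" "0 < r" "0 < s"
  shows "burkholder_function p r s \<le> ((p_star p - 1) * r) powr p - s powr p"
proof (cases "2 \<le> p")
  case True
  show ?thesis
  \<comment> \<open>For \<open>p = 2\<close> the factor \<open>p - 2\<close> loses the estimate, but both sides agree.\<close>
  proof (cases "p = 2")
    case True
    then show ?thesis
      using assms by (simp add: burkholder_function_def burkholder_form_def p_star_def algebra_simps power2_eq_square)
  next
    case False
    then have "0 \<le> ((p - 1) * r) powr p - s powr p - p * ((p - 1) / p) powr (p - 1) * burkholder_form p r s"
      using burkholder_form_gap_sign[OF assms] True by (simp add: zero_le_mult_iff)
    then show ?thesis using True p_star_minus_one[OF assms(1)] by (simp add: burkholder_function_def)
  qed
next
  case False
  \<comment> \<open>The estimate with \<open>r\<close> and \<open>s\<close> exchanged, divided by \<open>(p - 1) powr p\<close>; here \<open>p_star p - 1 = 1 / (p - 1)\<close>.\<close>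
  let ?K = "p * ((p - 1) / p) powr (p - 1) * burkholder_form p s r"
  have "((p - 1) * s) powr p - r powr p \<le> ?K"
    using burkholder_form_gap_sign[OF assms(1,3,2)] False by (simp add: zero_le_mult_iff)
  then have "(((p - 1) * s) powr p - r powr p) / (p - 1) powr p \<le> ?K / (p - 1) powr p"
    by (intro divide_right_mono) auto
  moreover have "((p - 1) * s) powr p = (p - 1) powr p * s powr p"
    using assms by (simp add: powr_mult)
  moreover have "r powr p / (p - 1) powr p = (1 / (p - 1) * r) powr p"
    using assms by (simp add: powr_divide)
  ultimately show ?thesis
    using False assms p_star_minus_one[OF assms(1)] 
    by (simp add: burkholder_function_def diff_divide_distrib)
qed

lemma smoothing_at_right:
  "((\<lambda>e. sqrt (c\<^sup>2 + e\<^sup>2)) \<longlongrightarrow> \<bar>c\<bar>) (at_right (0::real))"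
proof -
  have "((\<lambda>e. sqrt (c\<^sup>2 + e\<^sup>2)) \<longlongrightarrow> sqrt (c\<^sup>2 + 0\<^sup>2)) (at_right (0::real))"
    by (intro tendsto_intros)
  then show ?thesis by simp
qed

lemma tendsto_burkholder_function_smoothed:
  assumes "1 < p" "0 \<le> r" "0 \<le> s"
  shows "((\<lambda>e. burkholder_function p (sqrt (r\<^sup>2 + e\<^sup>2)) (sqrt (s\<^sup>2 + e\<^sup>2)))
    \<longlongrightarrow> burkholder_function p r s) (at_right 0)"
  by (rule tendsto_burkholder_function)
     (use assms smoothing_at_right[of r] smoothing_at_right[of s] in auto)

text \<open>
  The inequality for positive arguments passes to the closed quadrant by continuity.
\<close>

lemma burkholder_function_le:
  assumes "1 < p" "0 \<le> r" "0 \<le> s"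
  shows "burkholder_function p r s \<le> ((p_star p - 1) * r) powr p - s powr p"
proof (rule tendsto_le)
  have *: "0 \<le> p_star p - 1"
    using assms(1) by (simp add: p_star_def)
  show "((\<lambda>e. ((p_star p - 1) * sqrt (r\<^sup>2 + e\<^sup>2)) powr p - sqrt (s\<^sup>2 + e\<^sup>2) powr p)
      \<longlongrightarrow> ((p_star p - 1) * r) powr p - s powr p) (at_right 0)"
    using smoothing_at_right[of r] smoothing_at_right[of s] assms *
    by (intro tendsto_diff tendsto_powr' tendsto_mult tendsto_const) (auto intro!: always_eventually)
  show "\<forall>\<^sub>F e in at_right 0. burkholder_function p (sqrt (r\<^sup>2 + e\<^sup>2)) (sqrt (s\<^sup>2 + e\<^sup>2))
      \<le> ((p_star p - 1) * sqrt (r\<^sup>2 + e\<^sup>2)) powr p - sqrt (s\<^sup>2 + e\<^sup>2) powr p"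
    using eventually_at_right_less[of "0::real"]
  proof eventually_elim
    case (elim e)
    show ?case by (rule burkholder_function_le_pos[OF assms(1)]) (use elim in \<open>simp_all add: add_nonneg_pos\<close>)
  qed
qed (use tendsto_burkholder_function_smoothed[OF assms] in auto)

text \<open>
  The convexity behind everything: Burkholder's function of two norms is convex on lines along which
  the first component moves at least as fast as the second. For smoothed norms this is the sign of a
  second derivative, and the convexity inequality survives the limit of vanishing smoothing.
\<close>

lemma burkholder_function_convex_on_line:
  fixes x h :: "'a::real_inner" and y k :: "'b::real_inner"
  assumes p: "1 < p" and hk: "norm k \<le> norm h" and u: "0 \<le> u" "u \<le> 1"
  shows "burkholder_function p (norm (x + u *\<^sub>R h)) (norm (y + u *\<^sub>R k))
    \<le> (1 - u) * burkholder_function p (norm x) (norm y)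
      + u * burkholder_function p (norm (x + h)) (norm (y + k))"
proof -
  define \<phi> where "\<phi> e t = burkholder_function p (sqrt ((norm (x + t *\<^sub>R h))\<^sup>2 + e\<^sup>2))
      (sqrt ((norm (y + t *\<^sub>R k))\<^sup>2 + e\<^sup>2))" for e t
  have lim: "((\<lambda>e. \<phi> e t) \<longlongrightarrow> burkholder_function p (norm (x + t *\<^sub>R h)) (norm (y + t *\<^sub>R k)))
      (at_right 0)" for t
    unfolding \<phi>_def by (rule tendsto_burkholder_function_smoothed[OF p]) auto
  have cvx: "convex_on UNIV (\<phi> e)" if "0 < e" for e
  proof (cases "2 \<le> p")
    case True
    have "convex_on UNIV (\<lambda>t. p * ((p - 1) / p) powr (p - 1) * burkholder_form p
        (sqrt ((norm (x + t *\<^sub>R h))\<^sup>2 + e\<^sup>2)) (sqrt ((norm (y + t *\<^sub>R k))\<^sup>2 + e\<^sup>2)))"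
      by (rule convex_on_cmul, use p in simp)
         (rule convex_on_burkholder_form_smoothed(1)[OF that p True hk])
    then show ?thesis using True by (simp add: \<phi>_def[abs_def] burkholder_function_def)
  next
    case False
    have "convex_on UNIV (\<lambda>t. p * ((p - 1) / p) powr (p - 1) / (p - 1) powr p * - burkholder_form p
        (sqrt ((norm (y + t *\<^sub>R k))\<^sup>2 + e\<^sup>2)) (sqrt ((norm (x + t *\<^sub>R h))\<^sup>2 + e\<^sup>2)))"
      by (rule convex_on_cmul, use p in simp)
         (rule convex_on_burkholder_form_smoothed(2)[OF that p _ hk], use False in simp)
    then show ?thesis using False by (simp add: \<phi>_def[abs_def] burkholder_function_def)
  qed
  have "burkholder_function p (norm (x + u *\<^sub>R h)) (norm (y + u *\<^sub>R k))
    \<le> (1 - u) * burkholder_function p (norm (x + 0 *\<^sub>R h)) (norm (y + 0 *\<^sub>R k))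
      + u * burkholder_function p (norm (x + 1 *\<^sub>R h)) (norm (y + 1 *\<^sub>R k))"
  proof (rule tendsto_le)
    show "((\<lambda>e. (1 - u) * \<phi> e 0 + u * \<phi> e 1) \<longlongrightarrow>
      (1 - u) * burkholder_function p (norm (x + 0 *\<^sub>R h)) (norm (y + 0 *\<^sub>R k))
      + u * burkholder_function p (norm (x + 1 *\<^sub>R h)) (norm (y + 1 *\<^sub>R k))) (at_right 0)"
      by (intro tendsto_intros lim)
    show "\<forall>\<^sub>F e in at_right 0. \<phi> e u \<le> (1 - u) * \<phi> e 0 + u * \<phi> e 1"
      using eventually_at_right_less[of "0::real"]
    proof eventually_elim
      case (elim e)
      show ?case using convex_onD[OF cvx[OF elim] u, of 0 1] by simp
    qed
  qed (use lim in auto)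
  then show ?thesis by simp
qed

section \<open>Matrices of rank one\<close>

text \<open>
  The minors express rank at most one by polynomial equations, which makes closedness and
  invariance under scaling immediate.
\<close>

lemma rank_le_1_iff_minors:
  fixes A :: "real ^ 'n ^ 'm"
  shows "rank A \<le> 1 \<longleftrightarrow> (\<forall>i j k l. A $ i $ j * A $ k $ l = A $ i $ l * A $ k $ j)"
proof
  assume "rank A \<le> 1"
  obtain S where S: "S \<subseteq> rows A" "independent S" "rows A \<subseteq> span S" "card S = dim (rows A)"
    using basis_exists by blast
  have "finite S" using S(2) by (rule finiteI_independent)
  have "card S \<le> 1" using S(4) \<open>rank A \<le> 1\<close> by (simp add: row_rank_def)
  then obtain v where "S \<subseteq> {v}"
    using \<open>finite S\<close> by (metis One_nat_def card_le_Suc0_iff_eq insertI1 subsetI singleton_iff)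
  then have "rows A \<subseteq> span {v}"
    using S(3) span_mono by blast
  then have "\<exists>c. row i A = c *\<^sub>R v" for i
    by (auto simp: rows_def span_singleton)
  then obtain c where c: "\<And>i. row i A = c i *\<^sub>R v" by metis
  have "A $ i $ j = c i * v $ j" for i j
    using c[of i] by (metis row_def vec_lambda_eta vector_scaleR_component real_scaleR_def)
  then show "\<forall>i j k l. A $ i $ j * A $ k $ l = A $ i $ l * A $ k $ j" by simp
next
  assume minors: "\<forall>i j k l. A $ i $ j * A $ k $ l = A $ i $ l * A $ k $ j"
  show "rank A \<le> 1"
  proof (cases "A = 0")
    case False
    then obtain k l where kl: "A $ k $ l \<noteq> 0" by (metis vec_eq_iff zero_index)
    have "row i A = (A $ i $ l / A $ k $ l) *\<^sub>R row k A" for i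
      using minors kl by (simp add: row_def vec_eq_iff nonzero_eq_divide_eq)
    then have "rows A \<subseteq> span {row k A}"
      unfolding rows_def span_singleton by blast
    then have "dim (rows A) \<le> dim {row k A}"
      by (rule dim_mono)
    moreover have "dim {row k A} \<le> 1" by simp
    ultimately show ?thesis unfolding row_rank_def by linarith
  qed simp
qed

lemma rank_1_iff_minors:
  fixes A :: "real ^ 'n ^ 'm"
  shows "rank A = 1 \<longleftrightarrow> A \<noteq> 0 \<and> (\<forall>i j k l. A $ i $ j * A $ k $ l = A $ i $ l * A $ k $ j)"
  unfolding rank_le_1_iff_minors[symmetric] using rank_eq_0[of A] by linarith

lemma rank_1_scaleR:
  fixes A :: "real ^ 'n ^ 'm"
  assumes "rank A = 1" "c \<noteq> 0"
  shows "rank (c *\<^sub>R A) = 1"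
  using assms unfolding rank_1_iff_minors by (simp add: mult_ac)

text \<open>
  On the unit sphere, rank one is the same as rank at most one, which is a closed condition.
\<close>

lemma compact_unit_rank_1:
  "compact {A :: real ^ 'n ^ 'm. norm A = 1 \<and> rank A = 1}"
proof -
  have "{A :: real ^ 'n ^ 'm. norm A = 1 \<and> rank A = 1} =
      sphere 0 1 \<inter> {A. \<forall>i j k l. A $ i $ j * A $ k $ l = A $ i $ l * A $ k $ j}"
    unfolding rank_1_iff_minors by (auto simp: dist_norm)
  moreover have "closed {A :: real ^ 'n ^ 'm. \<forall>i j k l. A $ i $ j * A $ k $ l = A $ i $ l * A $ k $ j}"
    by (intro closed_Collect_all closed_Collect_eq continuous_intros)
  ultimately show ?thesis by (simp add: compact_Int_closed)
qed

section \<open>Orthogonal projections\<close>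

lemma orth_proj_unique:
  fixes X :: "'a::euclidean_space set"
  assumes "subspace X" "b \<in> X" "a - b \<in> orthogonal_comp X"
  shows "orth_proj X a = b"
  unfolding orth_proj_def using assms orth_proj_ex1[OF assms(1), of a] by (intro the1_equality) auto

lemma orth_proj_mem:
  fixes X :: "'a::euclidean_space set"
  assumes "subspace X"
  shows "orth_proj X a \<in> X" "a - orth_proj X a \<in> orthogonal_comp X"
  unfolding orth_proj_def using theI'[OF orth_proj_ex1[OF assms, of a]] by auto

lemma linear_orth_proj:
  fixes X :: "'a::euclidean_space set"
  assumes X: "subspace X"
  shows "linear (orth_proj X)"
proof (rule linearI)
  note Y = subspace_orthogonal_comp[of X]
  fix a b :: 'a and c :: real
  have "a + b - (orth_proj X a + orth_proj X b) = (a - orth_proj X a) + (b - orth_proj X b)" by simp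
  then show "orth_proj X (a + b) = orth_proj X a + orth_proj X b"
    by (intro orth_proj_unique[OF X])
       (simp_all only: subspace_add[OF X] subspace_add[OF Y] orth_proj_mem[OF X])
  have "c *\<^sub>R a - c *\<^sub>R orth_proj X a = c *\<^sub>R (a - orth_proj X a)" by (simp add: algebra_simps)
  then show "orth_proj X (c *\<^sub>R a) = c *\<^sub>R orth_proj X a"
    by (intro orth_proj_unique[OF X])
       (auto intro!: subspace_scale[OF X] subspace_scale[OF Y] orth_proj_mem[OF X])
qed

lemma orth_proj_orthogonal_comp:
  fixes X :: "'a::euclidean_space set"
  assumes X: "subspace X"
  shows "orth_proj (orthogonal_comp X) a = a - orth_proj X a"
  using orth_proj_mem[OF X, of a]
  by (intro orth_proj_unique[OF subspace_orthogonal_comp]) (auto simp: orthogonal_comp_self[OF X])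

lemma norm_orth_proj_le:
  fixes X :: "'a::euclidean_space set"
  assumes "subspace X"
  shows "norm (orth_proj X a) \<le> norm a"
proof -
  have "orthogonal (orth_proj X a) (a - orth_proj X a)"
    using orth_proj_mem[OF assms, of a] by (auto simp: orthogonal_comp_def)
  from norm_add_Pythagorean[OF this] have "(norm (orth_proj X a))\<^sup>2 \<le> (norm a)\<^sup>2" by simp
  then show ?thesis by (simp add: power_mono_iff)
qed

section \<open>The ratio constant\<close>

text \<open>
  If \<open>A\<close> has rank one, its projection to \<open>X\<close> cannot vanish, as otherwise \<open>A\<close> would lie in the complement.
  By compactness the norm of the projection has a positive minimum over the unit matrices of
  rank one; scaling gives the general case.
\<close>

lemma rank_1_orth_proj_lower_bound:
  fixes X :: "(real ^ 'd ^ 'd) set"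
  assumes X: "subspace X" and no: "\<not> (\<exists>A\<in>orthogonal_comp X. rank A = 1)"
  obtains m where "0 < m" "\<And>A. rank A = 1 \<Longrightarrow> m * norm A \<le> norm (orth_proj X A)"
proof -
  let ?K = "{A :: real ^ 'd ^ 'd. norm A = 1 \<and> rank A = 1}"
  have pos: "0 < norm (orth_proj X A)" if "rank A = 1" for A
    using no that orth_proj_mem(2)[OF X, of A] by (metis diff_zero zero_less_norm_iff)
  have unit: "A /\<^sub>R norm A \<in> ?K" if "rank A = 1" for A
  proof -
    have "A \<noteq> 0" using that by auto
    then show ?thesis using rank_1_scaleR[OF that, of "inverse (norm A)"] by simp
  qed
  show thesis
  proof (cases "?K = {}")
    case True
    then have "rank A \<noteq> 1" for A :: "real ^ 'd ^ 'd" using unit[of A] by blast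
    then show thesis by (intro that[of 1]) simp_all
  next
    case False
    have "continuous_on ?K (\<lambda>A. norm (orth_proj X A))"
      by (intro continuous_on_norm linear_continuous_on linear_conv_bounded_linear[THEN iffD1] linear_orth_proj X)
    from continuous_attains_inf[OF compact_unit_rank_1 False this]
    obtain A0 where A0: "A0 \<in> ?K" "\<And>A. A \<in> ?K \<Longrightarrow> norm (orth_proj X A0) \<le> norm (orth_proj X A)" by blast
    show thesis
    proof (rule that[of "norm (orth_proj X A0)"])
      show "0 < norm (orth_proj X A0)" using A0(1) pos by blast
      fix A :: "real ^ 'd ^ 'd" assume A: "rank A = 1"
      then have "0 < norm A" by auto
      have "norm (orth_proj X A0) \<le> norm (orth_proj X (A /\<^sub>R norm A))"
        using A0(2) unit[OF A] by blast
      also have "\<dots> = norm (orth_proj X A) / norm A"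
        by (simp add: linear_cmul[OF linear_orth_proj[OF X]] divide_inverse mult.commute)
      finally show "norm (orth_proj X A0) * norm A \<le> norm (orth_proj X A)"
        using \<open>0 < norm A\<close> by (simp add: le_divide_eq)
    qed
  qed
qed

text \<open>
  The lower bound keeps the infimum of the ratios away from \<open>0\<close>, so its inverse is finite. If the
  infimum is \<open>\<infinity>\<close>, then \<open>B = 0\<close>, and the inequality holds because every matrix of rank one lies in \<open>X\<close>.
\<close>

lemma ratio_const_finite:
  fixes X :: "(real ^ 'd ^ 'd) set"
  assumes X: "subspace X" and no: "\<not> (\<exists>A\<in>orthogonal_comp X. rank A = 1)"
  obtains B where "0 \<le> B" "ereal B = ratio_const X"
    "\<And>A. rank A = 1 \<Longrightarrow> norm (orth_proj (orthogonal_comp X) A) \<le> B * norm (orth_proj X A)"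
proof -
  define I where "I = (INF A\<in>{A. rank A = 1}. proj_ratio X A)"
  obtain m where m: "0 < m" "\<And>A. rank A = 1 \<Longrightarrow> m * norm A \<le> norm (orth_proj X A)"
    using rank_1_orth_proj_lower_bound[OF X no] by blast
  have "ereal m \<le> I"
    unfolding I_def
  proof (rule INF_greatest)
    fix A :: "real ^ 'd ^ 'd" assume "A \<in> {A. rank A = 1}"
    then have "m * norm (orth_proj (orthogonal_comp X) A) \<le> norm (orth_proj X A)"
      using order_trans[OF mult_left_mono[OF norm_orth_proj_le[OF subspace_orthogonal_comp, of X A]] m(2)[of A]] m(1)
      by simp
    then show "ereal m \<le> proj_ratio X A"
      by (simp add: proj_ratio_def le_divide_eq)
  qed
  have ratio: "I \<le> proj_ratio X A" if "rank A = 1" for A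
    using that unfolding I_def by (intro INF_lower) simp
  show thesis
  proof (cases I)
    case (real i)
    then have i: "0 < i" using \<open>ereal m \<le> I\<close> m(1) by simp
    show thesis
    proof (rule that[of "inverse i"])
      show "ereal (inverse i) = ratio_const X"
        using i unfolding ratio_const_def I_def[symmetric] real by simp
      fix A :: "real ^ 'd ^ 'd" assume "rank A = 1"
      then have "ereal i \<le> proj_ratio X A" using ratio unfolding real by blast
      then show "norm (orth_proj (orthogonal_comp X) A) \<le> inverse i * norm (orth_proj X A)"
      proof (cases "orth_proj (orthogonal_comp X) A = 0")
        case False
        then have "i * norm (orth_proj (orthogonal_comp X) A) \<le> norm (orth_proj X A)"
          using \<open>ereal i \<le> proj_ratio X A\<close> by (simp add: proj_ratio_def le_divide_eq)
        then show ?thesis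
          using i by (simp add: inverse_eq_divide le_divide_eq mult.commute)
      qed (use i in simp)
    qed (use i in simp)
  next
    case PInf
    show thesis
    proof (rule that[of 0])
      show "ereal 0 = ratio_const X" unfolding ratio_const_def I_def[symmetric] PInf by simp
      fix A :: "real ^ 'd ^ 'd" assume "rank A = 1"
      then have "\<infinity> \<le> proj_ratio X A" using ratio unfolding PInf by blast
      then show "norm (orth_proj (orthogonal_comp X) A) \<le> 0 * norm (orth_proj X A)"
        by (simp add: proj_ratio_def split: if_splits)
    qed simp
  next
    case MInf
    then show thesis using \<open>ereal m \<le> I\<close> by simp
  qed
qed

section \<open>Rank-one convex envelopes\<close>

text \<open>
  Any single rank-one convex minorant bounds the supremum from below, and \<open>f\<close> bounds it from above.
  Hence only the existence of a minorant matters.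
\<close>

lemma rc_envelope_real_valued_iff:
  "rc_envelope_real_valued f \<longleftrightarrow> (\<exists>g. rank_one_convex g \<and> (\<forall>M. g M \<le> f M))"
proof
  assume *: "rc_envelope_real_valued f"
  show "\<exists>g. rank_one_convex g \<and> (\<forall>M. g M \<le> f M)"
  proof (rule ccontr)
    assume "\<not> ?thesis"
    then have "{g. rank_one_convex g \<and> (\<forall>M. g M \<le> f M)} = {}" by blast
    then have "rc_envelope f A = - \<infinity>" for A
      unfolding rc_envelope_def by (simp only: image_empty Sup_empty bot_ereal_def)
    then show False using * by (simp add: rc_envelope_real_valued_def)
  qed
next
  assume "\<exists>g. rank_one_convex g \<and> (\<forall>M. g M \<le> f M)"
  then obtain g where g: "rank_one_convex g" "\<And>M. g M \<le> f M" by blast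
  show "rc_envelope_real_valued f"
    unfolding rc_envelope_real_valued_def
  proof
    fix A
    have "ereal (g A) \<le> rc_envelope f A"
      unfolding rc_envelope_def using g by (intro SUP_upper) auto
    moreover have "rc_envelope f A \<le> ereal (f A)"
      unfolding rc_envelope_def by (intro SUP_least) auto
    ultimately show "\<bar>rc_envelope f A\<bar> \<noteq> \<infinity>"
      by (cases "rc_envelope f A") simp_all
  qed
qed

lemma rank_one_convexI:
  fixes g :: "real ^ 'd ^ 'd \<Rightarrow> real"
  assumes "\<And>M H u. rank H = 1 \<Longrightarrow> 0 \<le> u \<Longrightarrow> u \<le> 1 \<Longrightarrow>
     g (M + u *\<^sub>R H) \<le> (1 - u) * g M + u * g (M + H)"
  shows "rank_one_convex g"
  unfolding rank_one_convex_def
proof (intro allI impI convex_onI)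
  fix A B M N :: "real ^ 'd ^ 'd" and u :: real
  assume AB: "rank (A - B) = 1" and u: "0 < u" "u < 1"
    and M: "M \<in> closed_segment A B" and N: "N \<in> closed_segment A B"
  obtain a b where "M = (1 - a) *\<^sub>R A + a *\<^sub>R B" "N = (1 - b) *\<^sub>R A + b *\<^sub>R B"
    using M N by (auto simp: closed_segment_def)
  then have NM: "N - M = (a - b) *\<^sub>R (A - B)"
    by (simp only:) (simp add: algebra_simps)
  show "g ((1 - u) *\<^sub>R M + u *\<^sub>R N) \<le> (1 - u) * g M + u * g N"
  proof (cases "a = b")
    case True
    then have "N = M" using NM by simp
    then show ?thesis by (simp add: algebra_simps)
  next
    case False
    then have "rank (N - M) = 1" unfolding NM using AB by (intro rank_1_scaleR) auto
    from assms[OF this, of u M] u show ?thesis by (simp add: algebra_simps)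
  qed
qed simp

text \<open>
  The minorant is Burkholder's function of \<open>B\<close> times the projection to \<open>X\<close> and of the projection to the
  complement. The hypothesis on \<open>B\<close> says that in a direction of rank one the first of these moves at
  least as fast as the second, which is what convexity on lines requires.
\<close>

lemma rc_envelope_real_valued_f_C:
  fixes X :: "(real ^ 'd ^ 'd) set"
  assumes p: "1 < p" and X: "subspace X" and B: "0 \<le> B"
    and le: "\<And>A. rank A = 1 \<Longrightarrow> norm (orth_proj (orthogonal_comp X) A) \<le> B * norm (orth_proj X A)"
  shows "rc_envelope_real_valued (f_C X p ((p_star p - 1) * B))"
proof -
  let ?P = "orth_proj X" and ?Q = "orth_proj (orthogonal_comp X)"
  define g where "g A = burkholder_function p (norm (B *\<^sub>R ?P A)) (norm (?Q A))" for A
  note linP = linear_orth_proj[OF X] and linQ = linear_orth_proj[OF subspace_orthogonal_comp, of X]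
  have "rank_one_convex g"
  proof (rule rank_one_convexI)
    fix M H :: "real ^ 'd ^ 'd" and u :: real
    assume "rank H = 1" and u: "0 \<le> u" "u \<le> 1"
    then have "norm (?Q H) \<le> norm (B *\<^sub>R ?P H)" using le B by simp
    from burkholder_function_convex_on_line[OF p this u, of "B *\<^sub>R ?P M" "?Q M"]
    show "g (M + u *\<^sub>R H) \<le> (1 - u) * g M + u * g (M + H)"
      by (simp add: g_def linear_add[OF linP] linear_add[OF linQ] linear_cmul[OF linP]
          linear_cmul[OF linQ] scaleR_add_right mult.commute)
  qed
  moreover have "g A \<le> f_C X p ((p_star p - 1) * B) A" for A
  proof -
    have "0 \<le> (p_star p - 1) * B" using p B by (simp add: p_star_def)
    then have "((p_star p - 1) * B) powr p * norm (?P A) powr p = ((p_star p - 1) * (B * norm (?P A))) powr p"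
      by (simp add: powr_mult mult.assoc[symmetric])
    then show ?thesis
      using burkholder_function_le[OF p, of "norm (B *\<^sub>R ?P A)" "norm (?Q A)"] B
      by (simp add: g_def f_C_def)
  qed
  ultimately show ?thesis unfolding rc_envelope_real_valued_iff by blast
qed

text \<open>
  On the line through \<open>0\<close> and \<open>A\<close> the function is \<open>- (\<bar>t\<bar> * norm A) powr p\<close>. A convex minorant is at
  \<open>0\<close> at most the mean of its values at \<open>t *\<^sub>R A\<close> and \<open>- t *\<^sub>R A\<close>, hence at most \<open>- (t * norm A) powr p\<close> for
  every \<open>t > 0\<close>.
\<close>

lemma not_rc_envelope_real_valued_f_C:
  fixes X :: "(real ^ 'd ^ 'd) set"
  assumes p: "1 < p" and X: "subspace X" and A: "A \<in> orthogonal_comp X" "rank A = 1"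
  shows "\<not> rc_envelope_real_valued (f_C X p C)"
proof
  assume "rc_envelope_real_valued (f_C X p C)"
  then obtain g where g: "rank_one_convex g" "\<And>M. g M \<le> f_C X p C M"
    unfolding rc_envelope_real_valued_iff by blast
  have A0: "A \<noteq> 0" using A(2) by auto
  have f: "f_C X p C (t *\<^sub>R A) = - ((\<bar>t\<bar> * norm A) powr p)" for t
  proof -
    have "t *\<^sub>R A \<in> orthogonal_comp X" by (rule subspace_scale[OF subspace_orthogonal_comp A(1)])
    then have "orth_proj X (t *\<^sub>R A) = 0"
      by (intro orth_proj_unique[OF X]) (auto simp: subspace_0[OF X])
    then show ?thesis using p by (simp add: f_C_def orth_proj_orthogonal_comp[OF X])
  qed
  have bound: "g 0 \<le> - ((t * norm A) powr p)" if "0 < t" for t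
  proof -
    have "rank (t *\<^sub>R A - (- t) *\<^sub>R A) = 1"
      using rank_1_scaleR[OF A(2), of "2 * t"] that by (simp add: scaleR_2[symmetric])
    then have "convex_on (closed_segment (t *\<^sub>R A) ((- t) *\<^sub>R A)) g"
      using g(1) unfolding rank_one_convex_def by blast
    from convex_onD[OF this, of "1/2" "t *\<^sub>R A" "(- t) *\<^sub>R A"]
    have "g 0 \<le> (1 / 2) * g (t *\<^sub>R A) + (1 / 2) * g ((- t) *\<^sub>R A)" by simp
    then show ?thesis
      using g(2)[of "t *\<^sub>R A"] g(2)[of "(- t) *\<^sub>R A"] f[of t] f[of "- t"] that by simp
  qed
  \<comment> \<open>Chosen so that the bound above reads \<open>g 0 \<le> - (\<bar>g 0\<bar> + 1)\<close>.\<close>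
  define t where "t = (\<bar>g 0\<bar> + 1) powr (1 / p) / norm A"
  have "0 < t" using A0 by (simp add: t_def)
  have "(t * norm A) powr p = \<bar>g 0\<bar> + 1"
    using A0 p by (simp add: t_def powr_powr)
  then show False using bound[OF \<open>0 < t\<close>] by simp
qed

theorem theorem2p1:
  fixes X :: "(real ^ 'd ^ 'd) set" and p :: real
  assumes "1 < p" and "subspace X"
  shows "((\<exists>C\<ge>0. rc_envelope_real_valued (f_C X p C))
            \<longleftrightarrow> \<not> (\<exists>A\<in>orthogonal_comp X. rank A = 1))
       \<and> (\<not> (\<exists>A\<in>orthogonal_comp X. rank A = 1) \<longrightarrow>
            (\<exists>B\<ge>0. ereal B = ratio_const X
                   \<and> rc_envelope_real_valued (f_C X p ((p_star p - 1) * B))))"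
proof -
  have B: "\<exists>B\<ge>0. ereal B = ratio_const X \<and> rc_envelope_real_valued (f_C X p ((p_star p - 1) * B))"
    if no: "\<not> (\<exists>A\<in>orthogonal_comp X. rank A = 1)"
  proof -
    obtain B where "0 \<le> B" "ereal B = ratio_const X"
      "\<And>A. rank A = 1 \<Longrightarrow> norm (orth_proj (orthogonal_comp X) A) \<le> B * norm (orth_proj X A)"
      using ratio_const_finite[OF assms(2) no] by blast
    with rc_envelope_real_valued_f_C[OF assms] show ?thesis by blast
  qed
  moreover have "\<exists>C\<ge>0. rc_envelope_real_valued (f_C X p C)"
    if no: "\<not> (\<exists>A\<in>orthogonal_comp X. rank A = 1)"
  proof -
    have "0 \<le> p_star p - 1" using assms(1) by (simp add: p_star_def)
    moreover obtain B where "0 \<le> B" "rc_envelope_real_valued (f_C X p ((p_star p - 1) * B))"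
      using B[OF no] by blast
    ultimately show ?thesis by (intro exI[of _ "(p_star p - 1) * B"]) simp
  qed
  moreover have "\<not> (\<exists>A\<in>orthogonal_comp X. rank A = 1)"
    if "\<exists>C\<ge>0. rc_envelope_real_valued (f_C X p C)"
    using that not_rc_envelope_real_valued_f_C[OF assms] by blast
  ultimately show ?thesis by blast
qed

end
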